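(* Let $T\in\mathbb{N}$ be arbitrary and suppose $c:\mathbb{X}\times\mathbb{U}\to\mathbb{R}$ is non-negative, measurable, and bounded. Then the $T$-stage optimal cost is continuous in the observation channel in the sense that if $\{Q_n\}$ is a sequence of channels converging to a channel $Q$ uniformly in total variation, then $$\lim_{n\to\infty}J(P,Q_n)=J(P,Q).$$
   Context: $\mathbb{X}\subset\mathbb{R}^n$, $\mathbb{Y}\subset\mathbb{R}^m$ and $\mathbb{U}$ (a nonempty subset of some Euclidean space) are Borel sets. A channel $Q$ is a stochastic kernel from $\mathbb{X}$ to $\mathbb{Y}$: $Q(\cdot|x)$ is a Borel probability measure on $\mathbb{Y}$ for every $x$, and $x\mapsto Q(A|x)$ is Borel measurable for every Borel $A\subset\mathbb{Y}$. $P$ is a probability measure on $\mathbb{X}$ (the distribution of the initial state $X_0$), and $P(\cdot|x,u)$ is a fixed stochastic kernel from $\mathbb{X}\times\mathbb{U}$ to $\mathbb{X}$. An admissible policy $\Pi$ is a sequence of measurable control functions $\{\gamma_t\}$ with $U_t=\gamma_t(I_t)\in\mathbb{U}$, where $I_0=\{Y_0\}$ and $I_t=\{Y_0,\dots,Y_t,U_0,\dots,U_{t-1}\}$ for $t\ge1$; $\mathscr{P}$ is the set of all admissible policies. Under policy $\Pi$ and channel $Q$, the state, observation and control processes satisfy $\Pr((X_0,Y_0)\in B)=\int_B P(dx_0)Q(dy_0|x_0)$ and, for $t\ge1$, conditionally on $X_{[0,t-1]}=x_{[0,t-1]}$, $Y_{[0,t-1]}=y_{[0,t-1]}$, $U_{[0,t-1]}=u_{[0,t-1]}$,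 $\Pr((X_t,Y_t)\in B\mid\cdot)=\int_B P(dx_t|x_{t-1},u_{t-1})Q(dy_t|x_t)$ for Borel $B\subset\mathbb{X}\times\mathbb{Y}$. The cost is $$J(P,Q,\Pi)=E_P^{Q,\Pi}\Bigl[\sum_{t=0}^{T-1}c(X_t,U_t)\Bigr],\qquad J(P,Q)=\inf_{\Pi\in\mathscr{P}}J(P,Q,\Pi).$$ $Q_n\to Q$ uniformly in total variation means $\lim_{n\to\infty}\sup_{x\in\mathbb{X}}\|Q_n(\cdot|x)-Q(\cdot|x)\|_{TV}=0$, where $\|\mu-\nu\|_{TV}=2\sup_B|\mu(B)-\nu(B)|$ over Borel sets $B$. *)

theory Defs
  imports "HOL-Probability.Probability"
begin

abbreviation borel_on :: "'a::topological_space set \<Rightarrow> 'a measure" where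
  "borel_on S \<equiv> restrict_space borel S"

abbreviation kernels :: "'a measure \<Rightarrow> 'b measure \<Rightarrow> ('a \<Rightarrow> 'b measure) set" where
  "kernels M N \<equiv> M \<rightarrow>\<^sub>M prob_algebra N"

definition channels ::
  "'x::euclidean_space set \<Rightarrow> 'y::euclidean_space set \<Rightarrow> ('x \<Rightarrow> 'y measure) set" where
  "channels X Y = kernels (borel_on X) (borel_on Y)"

(* At time t the controller sees the observations y_0, ..., y_t and the past controls
   u_0, ..., u_{t-1}, encoded as points of the product spaces over {0..t} and {0..<t}. *)
definition admissible_policies ::
  "'y::euclidean_space set \<Rightarrow> 'u::euclidean_space set
     \<Rightarrow> (nat \<Rightarrow> (nat \<Rightarrow> 'y) \<Rightarrow> (nat \<Rightarrow> 'u) \<Rightarrow> 'u) set" where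
  "admissible_policies Y U = {\<gamma>. \<forall>t. (\<lambda>(y, u). \<gamma> t y u) \<in>
     PiM {0..t} (\<lambda>_. borel_on Y) \<Otimes>\<^sub>M PiM {0..<t} (\<lambda>_. borel_on U) \<rightarrow>\<^sub>M borel_on U}"

abbreviation stage_space ::
  "'x::euclidean_space set \<Rightarrow> 'y::euclidean_space set \<Rightarrow> 'u::euclidean_space set
     \<Rightarrow> ('x \<times> 'y \<times> 'u) measure" where
  "stage_space X Y U \<equiv> borel_on X \<Otimes>\<^sub>M (borel_on Y \<Otimes>\<^sub>M borel_on U)"

abbreviation state_at :: "(nat \<Rightarrow> 'x \<times> 'y \<times> 'u) \<Rightarrow> nat \<Rightarrow> 'x" where
  "state_at \<omega> t \<equiv> fst (\<omega> t)"

abbreviation obs_at :: "(nat \<Rightarrow> 'x \<times> 'y \<times> 'u) \<Rightarrow> nat \<Rightarrow> 'y" where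
  "obs_at \<omega> t \<equiv> fst (snd (\<omega> t))"

abbreviation control_at :: "(nat \<Rightarrow> 'x \<times> 'y \<times> 'u) \<Rightarrow> nat \<Rightarrow> 'u" where
  "control_at \<omega> t \<equiv> snd (snd (\<omega> t))"

(* Conditional law of (X_t, Y_t, U_t) given the past h = (X_s, Y_s, U_s) for s < t. *)
definition stage_kernel ::
  "'x::euclidean_space set \<Rightarrow> 'y::euclidean_space set \<Rightarrow> 'u::euclidean_space set
     \<Rightarrow> 'x measure \<Rightarrow> ('x \<times> 'u \<Rightarrow> 'x measure) \<Rightarrow> ('x \<Rightarrow> 'y measure)
     \<Rightarrow> (nat \<Rightarrow> (nat \<Rightarrow> 'y) \<Rightarrow> (nat \<Rightarrow> 'u) \<Rightarrow> 'u)
     \<Rightarrow> nat \<Rightarrow> (nat \<Rightarrow> 'x \<times> 'y \<times> 'u) \<Rightarrow> ('x \<times> 'y \<times> 'u) measure" where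
  "stage_kernel X Y U P K Q \<gamma> t h =
     (case t of 0 \<Rightarrow> P | Suc s \<Rightarrow> K (state_at h s, control_at h s)) \<bind> (\<lambda>x.
      Q x \<bind> (\<lambda>y.
      return (stage_space X Y U)
        (x, y, \<gamma> t (\<lambda>s\<in>{0..t}. if s = t then y else obs_at h s)
                   (\<lambda>s\<in>{0..<t}. control_at h s))))"

(* The law of the whole process (X_t, Y_t, U_t), t = 0, 1, ..., on the infinite product space:
   the Ionescu-Tulcea measure of the stage kernels. That the stage kernels satisfy the locale
   assumptions is Ionescu_Tulcea_stage_kernel below. *)
definition process_law ::
  "'x::euclidean_space set \<Rightarrow> 'y::euclidean_space set \<Rightarrow> 'u::euclidean_space set
     \<Rightarrow> 'x measure \<Rightarrow> ('x \<times> 'u \<Rightarrow> 'x measure) \<Rightarrow> ('x \<Rightarrow> 'y measure)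
     \<Rightarrow> (nat \<Rightarrow> (nat \<Rightarrow> 'y) \<Rightarrow> (nat \<Rightarrow> 'u) \<Rightarrow> 'u)
     \<Rightarrow> (nat \<Rightarrow> 'x \<times> 'y \<times> 'u) measure" where
  "process_law X Y U P K Q \<gamma> =
     projective_family.lim UNIV
       (Ionescu_Tulcea.CI (stage_kernel X Y U P K Q \<gamma>) (\<lambda>_. stage_space X Y U))
       (\<lambda>_. stage_space X Y U)"

definition policy_cost ::
  "'x::euclidean_space set \<Rightarrow> 'y::euclidean_space set \<Rightarrow> 'u::euclidean_space set
     \<Rightarrow> ('x \<times> 'u \<Rightarrow> 'x measure) \<Rightarrow> ('x \<times> 'u \<Rightarrow> real) \<Rightarrow> nat
     \<Rightarrow> 'x measure \<Rightarrow> ('x \<Rightarrow> 'y measure)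
     \<Rightarrow> (nat \<Rightarrow> (nat \<Rightarrow> 'y) \<Rightarrow> (nat \<Rightarrow> 'u) \<Rightarrow> 'u) \<Rightarrow> real" where
  "policy_cost X Y U K c T P Q \<gamma> =
     (\<integral>\<omega>. (\<Sum>t<T. c (state_at \<omega> t, control_at \<omega> t)) \<partial>process_law X Y U P K Q \<gamma>)"

definition optimal_cost ::
  "'x::euclidean_space set \<Rightarrow> 'y::euclidean_space set \<Rightarrow> 'u::euclidean_space set
     \<Rightarrow> ('x \<times> 'u \<Rightarrow> 'x measure) \<Rightarrow> ('x \<times> 'u \<Rightarrow> real) \<Rightarrow> nat
     \<Rightarrow> 'x measure \<Rightarrow> ('x \<Rightarrow> 'y measure) \<Rightarrow> real" where
  "optimal_cost X Y U K c T P Q =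
     (INF \<gamma>\<in>admissible_policies Y U. policy_cost X Y U K c T P Q \<gamma>)"

definition tv_dist :: "'a measure \<Rightarrow> 'a measure \<Rightarrow> 'a measure \<Rightarrow> real" where
  "tv_dist N \<mu> \<nu> = 2 * (SUP B\<in>sets N. \<bar>measure \<mu> B - measure \<nu> B\<bar>)"

definition uniform_tv_converges ::
  "'x::euclidean_space set \<Rightarrow> 'y::euclidean_space set
     \<Rightarrow> (nat \<Rightarrow> 'x \<Rightarrow> 'y measure) \<Rightarrow> ('x \<Rightarrow> 'y measure) \<Rightarrow> bool" where
  "uniform_tv_converges X Y Qn Q \<longleftrightarrow>
     (\<lambda>n. SUP x\<in>X. tv_dist (borel_on Y) (Qn n x) (Q x)) \<longlonglongrightarrow> 0"

lemma stage_kernel_measurable: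
  assumes P: "P \<in> space (prob_algebra (borel_on X))"
    and K: "K \<in> kernels (borel_on X \<Otimes>\<^sub>M borel_on U) (borel_on X)"
    and Q: "Q \<in> channels X Y"
    and \<gamma>: "\<gamma> \<in> admissible_policies Y U"
  shows "stage_kernel X Y U P K Q \<gamma> t
           \<in> kernels (PiM {0..<t} (\<lambda>_. stage_space X Y U)) (stage_space X Y U)"
proof -
  let ?H = "PiM {0..<t} (\<lambda>_. stage_space X Y U)"
  note K[measurable] Q[unfolded channels_def, measurable]
  have g: "(\<lambda>(y, u). \<gamma> t y u) \<in>
     PiM {0..t} (\<lambda>_. borel_on Y) \<Otimes>\<^sub>M PiM {0..<t} (\<lambda>_. borel_on U) \<rightarrow>\<^sub>M borel_on U"
    using \<gamma> by (auto simp: admissible_policies_def)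
  have comp: "(\<lambda>h. h s) \<in> ?H \<rightarrow>\<^sub>M stage_space X Y U" if "s < t" for s
    using that by (intro measurable_component_singleton) simp
  have 1: "(\<lambda>h. case t of 0 \<Rightarrow> P | Suc s \<Rightarrow> K (state_at h s, control_at h s)) \<in> kernels ?H (borel_on X)"
  proof (cases t)
    case 0
    then show ?thesis using P by simp
  next
    case (Suc s)
    have [measurable]: "(\<lambda>h. h s) \<in> ?H \<rightarrow>\<^sub>M stage_space X Y U"
      using comp Suc by simp
    have "(\<lambda>h. (state_at h s, control_at h s)) \<in> ?H \<rightarrow>\<^sub>M borel_on X \<Otimes>\<^sub>M borel_on U"
      by measurable
    from measurable_compose[OF this K] show ?thesis
      using Suc by simp
  qed
  let ?R = "(?H \<Otimes>\<^sub>M borel_on X) \<Otimes>\<^sub>M borel_on Y"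
  have hs: "(\<lambda>p. fst (fst p) s) \<in> ?R \<rightarrow>\<^sub>M stage_space X Y U" if "s < t" for s
    by (rule measurable_compose[OF measurable_compose[OF measurable_fst measurable_fst] comp[OF that]])
  have ys: "(\<lambda>p. \<lambda>s\<in>{0..t}. if s = t then snd p else obs_at (fst (fst p)) s)
              \<in> ?R \<rightarrow>\<^sub>M PiM {0..t} (\<lambda>_. borel_on Y)"
  proof (rule measurable_restrict)
    fix s assume s: "s \<in> {0..t}"
    show "(\<lambda>p. if s = t then snd p else obs_at (fst (fst p)) s) \<in> ?R \<rightarrow>\<^sub>M borel_on Y"
    proof (cases "s = t")
      case False
      with s have [measurable]: "(\<lambda>p. fst (fst p) s) \<in> ?R \<rightarrow>\<^sub>M stage_space X Y U"
        by (intro hs) auto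
      show ?thesis using False by simp
    qed simp
  qed
  have us: "(\<lambda>p. \<lambda>s\<in>{0..<t}. control_at (fst (fst p)) s)
              \<in> ?R \<rightarrow>\<^sub>M PiM {0..<t} (\<lambda>_. borel_on U)"
  proof (rule measurable_restrict)
    fix s assume "s \<in> {0..<t}"
    then have [measurable]: "(\<lambda>p. fst (fst p) s) \<in> ?R \<rightarrow>\<^sub>M stage_space X Y U"
      by (intro hs) auto
    show "(\<lambda>p. control_at (fst (fst p)) s) \<in> ?R \<rightarrow>\<^sub>M borel_on U"
      by measurable
  qed
  have gm[measurable]: "(\<lambda>p. \<gamma> t (\<lambda>s\<in>{0..t}. if s = t then snd p else obs_at (fst (fst p)) s)
                   (\<lambda>s\<in>{0..<t}. control_at (fst (fst p)) s)) \<in> ?R \<rightarrow>\<^sub>M borel_on U"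
    using measurable_compose[OF measurable_Pair[OF ys us] g] by simp
  have 2: "(\<lambda>p. return (stage_space X Y U) (snd (fst p), snd p,
               \<gamma> t (\<lambda>s\<in>{0..t}. if s = t then snd p else obs_at (fst (fst p)) s)
                   (\<lambda>s\<in>{0..<t}. control_at (fst (fst p)) s)))
             \<in> kernels ?R (stage_space X Y U)"
    by (rule measurable_compose[OF _ measurable_return_prob_space]) measurable
  have 3: "(\<lambda>p. Q (snd p) \<bind> (\<lambda>y. return (stage_space X Y U) (snd p, y,
               \<gamma> t (\<lambda>s\<in>{0..t}. if s = t then y else obs_at (fst p) s)
                   (\<lambda>s\<in>{0..<t}. control_at (fst p) s))))
             \<in> kernels (?H \<Otimes>\<^sub>M borel_on X) (stage_space X Y U)"
    by (rule measurable_bind_prob_space2[where N="borel_on Y"])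
       (use 2 in \<open>simp_all add: split_beta' del: restrict_apply\<close>)
  show ?thesis
    unfolding stage_kernel_def[abs_def]
    by (rule measurable_bind_prob_space2[OF 1]) (use 3 in \<open>simp add: split_beta'\<close>)
qed

lemma Ionescu_Tulcea_stage_kernel:
  assumes "P \<in> space (prob_algebra (borel_on X))"
    and "K \<in> kernels (borel_on X \<Otimes>\<^sub>M borel_on U) (borel_on X)"
    and "Q \<in> channels X Y"
    and "\<gamma> \<in> admissible_policies Y U"
  shows "Ionescu_Tulcea (stage_kernel X Y U P K Q \<gamma>) (\<lambda>_. stage_space X Y U)"
proof (rule Ionescu_Tulcea.intro)
  note m = stage_kernel_measurable[OF assms]
  show "stage_kernel X Y U P K Q \<gamma> t
          \<in> PiM {0..<t} (\<lambda>_. stage_space X Y U) \<rightarrow>\<^sub>M subprob_algebra (stage_space X Y U)" for t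
    using m by (rule measurable_prob_algebraD)
  show "prob_space (stage_kernel X Y U P K Q \<gamma> t h)"
    if "h \<in> space (PiM {0..<t} (\<lambda>_. stage_space X Y U))" for t h
    using measurable_space[OF m that] by (simp add: space_prob_algebra)
qed

end

theory Submission
  imports Defs
begin

text \<open>
  The idea is that the cost of a fixed policy is Lipschitz in the channel, with a constant that
  does not depend on the policy; infima of uniformly close functions are then close as well.

  Write \<open>d\<close> for the supremum over \<open>x\<close> of the total variation distance between \<open>Q x\<close> and \<open>Q' x\<close>,
  and let the cost per stage lie between \<open>0\<close> and \<open>b\<close>. Fix a policy and use it with both channels.
  In every stage the two processes differ only in the channel that produces the observation, so
  for one and the same past the conditional laws of the next stage differ by at most \<open>d\<close> on each
  event (\<open>stage_kernel_gap\<close>). A gap \<open>d\<close> on each event is a gap \<open>M * d\<close> on integrals of functions with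
  values between \<open>0\<close> and \<open>M\<close> (\<open>nn_integral_le_add_setwise_gap\<close>). Exchanging the channel stage by
  stage, a functional of the first \<open>n\<close> stages with these values therefore changes its expectation
  by at most \<open>n * (M * d)\<close> (\<open>Ionescu_Tulcea_setwise_gap\<close>). The accumulated cost depends on \<open>T\<close> stages
  and is at most \<open>T * b\<close>, which gives the bound \<open>T * (T * b * d)\<close> for the costs of the policy, hence
  for the optimal costs.

  All comparisons are one-sided, of the form \<open>\<mu> A \<le> \<nu> A + d\<close>. In this form they make sense for
  integrals in \<^typ>\<open>ennreal\<close>, where no integrability has to be tracked; the other side follows by
  exchanging the two channels.
\<close>

section \<open>Integrals against setwise close measures\<close>

text \<open>
  Layer cake: the integral of \<open>f\<close> is the integral over the levels \<open>t\<close> in \<open>{0..M}\<close> of the measure of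
  \<open>{x. t < f x}\<close>, and each of these level sets gains at most \<open>d\<close>.
\<close>

lemma nn_integral_le_add_setwise_gap:
  fixes f :: "'a \<Rightarrow> ennreal" and d M :: real
  assumes mu: "prob_space \<mu>" and nu: "prob_space \<nu>"
    and sets: "sets \<mu> = sets N" "sets \<nu> = sets N"
    and d: "0 \<le> d" and M: "0 \<le> M"
    and gap: "\<And>A. A \<in> sets N \<Longrightarrow> emeasure \<mu> A \<le> emeasure \<nu> A + ennreal d"
    and f: "f \<in> borel_measurable N" and f_le: "\<And>x. x \<in> space N \<Longrightarrow> f x \<le> ennreal M"
  shows "(\<integral>\<^sup>+x. f x \<partial>\<mu>) \<le> (\<integral>\<^sup>+x. f x \<partial>\<nu>) + ennreal (M * d)"
proof -
  have layers: "(\<integral>\<^sup>+x. f x \<partial>\<rho>) = (\<integral>\<^sup>+t. emeasure \<rho> {x \<in> space N. ennreal t < f x} * indicator {0..M} t \<partial>lborel)"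
    if "prob_space \<rho>" and sets_rho: "sets \<rho> = sets N" for \<rho>
  proof -
    interpret R: prob_space \<rho> by fact
    interpret P: pair_sigma_finite \<rho> lborel ..
    have space_rho: "space \<rho> = space N" using sets_rho by (rule sets_eq_imp_space_eq)
    have fm[measurable]: "f \<in> borel_measurable \<rho>"
      using f by (simp cong: measurable_cong_sets add: sets_rho measurable_cong_sets[OF sets_rho refl])
    \<comment> \<open>Levels are cut off at \<open>M\<close> so that a constant gap has a finite integral over the levels.\<close>
    let ?S = "\<lambda>x t. indicator {0..M} t * indicator {p. ennreal (snd p) < f (fst p)} (x, t) :: ennreal"
    have m: "(\<lambda>(x, t). ?S x t) \<in> borel_measurable (\<rho> \<Otimes>\<^sub>M lborel)"
      unfolding indicator_def by measurable
    have "f x = (\<integral>\<^sup>+t. ?S x t \<partial>lborel)" if x: "x \<in> space \<rho>" for x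
    proof -
      have "f x \<le> ennreal M" using f_le x space_rho by simp
      then have fin: "f x \<noteq> \<infinity>" by (auto simp: top_unique)
      define r where "r = enn2real (f x)"
      have r: "f x = ennreal r" "0 \<le> r" using fin by (auto simp: r_def less_top)
      have rM: "r \<le> M" using \<open>f x \<le> ennreal M\<close> r M by simp
      have "(\<integral>\<^sup>+t. ?S x t \<partial>lborel) = (\<integral>\<^sup>+t. indicator {0..<r} t \<partial>lborel)"
        using r rM by (intro nn_integral_cong) (auto simp: indicator_def ennreal_less_iff)
      then show ?thesis using r by simp
    qed
    then have "(\<integral>\<^sup>+x. f x \<partial>\<rho>) = (\<integral>\<^sup>+x. \<integral>\<^sup>+t. ?S x t \<partial>lborel \<partial>\<rho>)"
      by (rule nn_integral_cong)
    also have "\<dots> = (\<integral>\<^sup>+t. \<integral>\<^sup>+x. ?S x t \<partial>\<rho> \<partial>lborel)"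
      by (rule P.Fubini'[OF m, symmetric])
    also have "\<dots> = (\<integral>\<^sup>+t. emeasure \<rho> {x \<in> space N. ennreal t < f x} * indicator {0..M} t \<partial>lborel)"
    proof (rule nn_integral_cong)
      fix t :: real
      have *: "{x \<in> space \<rho>. ennreal t < f x} \<in> sets \<rho>" by measurable
      have "(\<integral>\<^sup>+x. ?S x t \<partial>\<rho>) = (\<integral>\<^sup>+x. indicator {0..M} t * indicator {x \<in> space \<rho>. ennreal t < f x} x \<partial>\<rho>)"
        by (intro nn_integral_cong) (auto simp: indicator_def)
      also have "\<dots> = indicator {0..M} t * emeasure \<rho> {x \<in> space \<rho>. ennreal t < f x}"
        using * by (rule nn_integral_cmult_indicator)
      finally show "(\<integral>\<^sup>+x. ?S x t \<partial>\<rho>) = emeasure \<rho> {x \<in> space N. ennreal t < f x} * indicator {0..M} t"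
        by (simp add: space_rho mult.commute)
    qed
    finally show ?thesis .
  qed
  have meas[measurable]: "(\<lambda>t. emeasure \<nu> {x \<in> space N. ennreal t < f x}) \<in> borel_measurable lborel"
  proof -
    interpret nu: prob_space \<nu> by fact
    have [measurable]: "f \<in> borel_measurable \<nu>"
      using f by (simp add: measurable_cong_sets[OF sets(2) refl])
    have "(\<lambda>t. emeasure \<nu> {x \<in> space \<nu>. ennreal t < f x}) \<in> borel_measurable lborel"
      by measurable
    then show ?thesis by (simp add: sets_eq_imp_space_eq[OF sets(2)])
  qed
  have "(\<integral>\<^sup>+x. f x \<partial>\<mu>) \<le> (\<integral>\<^sup>+t. emeasure \<nu> {x \<in> space N. ennreal t < f x} * indicator {0..M} t
            + ennreal d * indicator {0..M} t \<partial>lborel)"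
    unfolding layers[OF mu sets(1)]
  proof (rule nn_integral_mono)
    fix t :: real
    have "{x \<in> space N. ennreal t < f x} \<in> sets N" using f by measurable
    from gap[OF this] show "emeasure \<mu> {x \<in> space N. ennreal t < f x} * indicator {0..M} t
        \<le> emeasure \<nu> {x \<in> space N. ennreal t < f x} * indicator {0..M} t + ennreal d * indicator {0..M} t"
      by (auto simp: indicator_def)
  qed
  also have "\<dots> = (\<integral>\<^sup>+x. f x \<partial>\<nu>) + (\<integral>\<^sup>+t. ennreal d * indicator {0..M} t \<partial>lborel)"
    unfolding layers[OF nu sets(2)] by (intro nn_integral_add) measurable
  also have "(\<integral>\<^sup>+t. ennreal d * indicator {0..M} t \<partial>lborel) = ennreal (M * d)"
    using M d by (simp add: nn_integral_cmult_indicator ennreal_mult mult.commute)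
  finally show ?thesis .
qed

section \<open>Exchanging the channel in one stage\<close>

text \<open>
  The conditional law of a stage is a mixture, over the next state \<open>x\<close>, of images of the observation
  law. The mixing law of \<open>x\<close> and the map from observations to stages are the same for both channels,
  so the gap between \<open>Q x\<close> and \<open>Q' x\<close> passes to the mixture without growing.
\<close>

lemma stage_kernel_gap:
  assumes P: "P \<in> space (prob_algebra (borel_on X))"
    and K: "K \<in> kernels (borel_on X \<Otimes>\<^sub>M borel_on U) (borel_on X)"
    and Q: "Q \<in> channels X Y" and Q': "Q' \<in> channels X Y"
    and \<gamma>: "\<gamma> \<in> admissible_policies Y U"
    and d: "0 \<le> d"
    and gap: "\<And>x A. x \<in> X \<Longrightarrow> A \<in> sets (borel_on Y) \<Longrightarrow> emeasure (Q x) A \<le> emeasure (Q' x) A + ennreal d"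
    and h: "h \<in> space (PiM {0..<t} (\<lambda>_. stage_space X Y U))"
    and A: "A \<in> sets (stage_space X Y U)"
  shows "emeasure (stage_kernel X Y U P K Q \<gamma> t h) A \<le> emeasure (stage_kernel X Y U P K Q' \<gamma> t h) A + ennreal d"
proof -
  let ?S = "stage_space X Y U"
  define \<rho> where "\<rho> = (case t of 0 \<Rightarrow> P | Suc s \<Rightarrow> K (state_at h s, control_at h s))"
  define R where "R x y = return ?S (x, y, \<gamma> t (\<lambda>s\<in>{0..t}. if s = t then y else obs_at h s)
                   (\<lambda>s\<in>{0..<t}. control_at h s))" for x y
  have comp: "h s \<in> space ?S" if "s < t" for s
    using h that by (auto simp: space_PiM PiE_iff)
  have \<rho>: "\<rho> \<in> space (prob_algebra (borel_on X))"
  proof (cases t)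
    case 0 then show ?thesis using P by (simp add: \<rho>_def)
  next
    case (Suc s)
    then have "(state_at h s, control_at h s) \<in> space (borel_on X \<Otimes>\<^sub>M borel_on U)"
      using comp[of s] by (auto simp: space_pair_measure)
    with measurable_space[OF K this] Suc show ?thesis by (simp add: \<rho>_def)
  qed
  interpret rho: prob_space \<rho> using \<rho> by (simp add: space_prob_algebra)
  have sets_rho: "sets \<rho> = sets (borel_on X)" using \<rho> by (simp add: space_prob_algebra)
  have space_rho: "space \<rho> = X"
    using sets_eq_imp_space_eq[OF sets_rho] by (simp add: space_restrict_space)
  have g: "(\<lambda>(y, u). \<gamma> t y u) \<in>
     PiM {0..t} (\<lambda>_. borel_on Y) \<Otimes>\<^sub>M PiM {0..<t} (\<lambda>_. borel_on U) \<rightarrow>\<^sub>M borel_on U"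
    using \<gamma> by (auto simp: admissible_policies_def)
  have ys: "(\<lambda>y. \<lambda>s\<in>{0..t}. if s = t then y else obs_at h s)
              \<in> borel_on Y \<rightarrow>\<^sub>M PiM {0..t} (\<lambda>_. borel_on Y)"
  proof (rule measurable_restrict)
    fix s assume s: "s \<in> {0..t}"
    show "(\<lambda>y. if s = t then y else obs_at h s) \<in> borel_on Y \<rightarrow>\<^sub>M borel_on Y"
      using s comp[of s] by (cases "s = t") (auto simp: space_pair_measure mem_Times_iff)
  qed
  have us: "(\<lambda>s\<in>{0..<t}. control_at h s) \<in> space (PiM {0..<t} (\<lambda>_. borel_on U))"
    using comp by (auto simp: space_PiM space_pair_measure mem_Times_iff)
  have "(\<lambda>y. (\<lambda>s\<in>{0..t}. if s = t then y else obs_at h s, \<lambda>s\<in>{0..<t}. control_at h s))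
     \<in> borel_on Y \<rightarrow>\<^sub>M PiM {0..t} (\<lambda>_. borel_on Y) \<Otimes>\<^sub>M PiM {0..<t} (\<lambda>_. borel_on U)"
    by (rule measurable_Pair[OF ys measurable_const[OF us]])
  from measurable_compose[OF this g]
  have gm[measurable]: "(\<lambda>y. \<gamma> t (\<lambda>s\<in>{0..t}. if s = t then y else obs_at h s)
                   (\<lambda>s\<in>{0..<t}. control_at h s)) \<in> borel_on Y \<rightarrow>\<^sub>M borel_on U"
    by simp
  have R2: "(\<lambda>p. R (fst p) (snd p)) \<in> kernels (borel_on X \<Otimes>\<^sub>M borel_on Y) ?S"
    unfolding R_def by (rule measurable_compose[OF _ measurable_return_prob_space]) measurable
  have R1: "R x \<in> kernels (borel_on Y) ?S" if "x \<in> X" for x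
    using measurable_compose[OF measurable_Pair[OF measurable_const[of x "borel_on X"] measurable_ident] R2] that
    by (simp add: space_restrict_space)
  have chan: "(\<lambda>x. q x \<bind> R x) \<in> kernels (borel_on X) ?S" if "q \<in> channels X Y" for q
    using that R2 unfolding channels_def
    by (intro measurable_bind_prob_space2[where N="borel_on Y"]) (auto simp: split_beta')
  have kernel_eq: "emeasure (stage_kernel X Y U P K q \<gamma> t h) A = (\<integral>\<^sup>+x. emeasure (q x \<bind> R x) A \<partial>\<rho>)"
    if q: "q \<in> channels X Y" for q
  proof -
    have "(\<lambda>x. q x \<bind> R x) \<in> \<rho> \<rightarrow>\<^sub>M subprob_algebra ?S"
      using measurable_prob_algebraD[OF chan[OF q]] by (simp add: measurable_cong_sets[OF sets_rho refl])
    from emeasure_bind[OF rho.not_empty this A] show ?thesis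
      unfolding stage_kernel_def R_def \<rho>_def .
  qed
  have qprob: "prob_space (q x)" "sets (q x) = sets (borel_on Y)"
    if "q \<in> channels X Y" "x \<in> X" for q x
    using measurable_space[of q "borel_on X" "prob_algebra (borel_on Y)" x] that
    by (auto simp: channels_def space_prob_algebra space_restrict_space)
  have obs_eq: "emeasure (q x \<bind> R x) A = (\<integral>\<^sup>+y. emeasure (R x y) A \<partial>q x)"
    if q: "q \<in> channels X Y" and x: "x \<in> X" for q x
  proof -
    have "R x \<in> q x \<rightarrow>\<^sub>M subprob_algebra ?S"
      using measurable_prob_algebraD[OF R1[OF x]] by (simp add: measurable_cong_sets[OF qprob(2)[OF q x] refl])
    then show ?thesis
      by (rule emeasure_bind[OF prob_space.not_empty[OF qprob(1)[OF q x]] _ A])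
  qed
  have step: "emeasure (Q x \<bind> R x) A \<le> emeasure (Q' x \<bind> R x) A + ennreal d" if x: "x \<in> X" for x
  proof -
    have meas: "(\<lambda>y. emeasure (R x y) A) \<in> borel_measurable (borel_on Y)"
      by (rule measurable_compose[OF measurable_prob_algebraD[OF R1[OF x]] measurable_emeasure_subprob_algebra[OF A]])
    have le1: "emeasure (R x y) A \<le> ennreal 1" if "y \<in> space (borel_on Y)" for y
      by (simp add: R_def A indicator_def)
    show ?thesis
      using nn_integral_le_add_setwise_gap[OF qprob(1)[OF Q x] qprob(1)[OF Q' x] qprob(2)[OF Q x]
          qprob(2)[OF Q' x] d _ gap[OF x] meas le1]
      by (simp add: obs_eq Q Q' x)
  qed
  have "(\<integral>\<^sup>+x. emeasure (Q x \<bind> R x) A \<partial>\<rho>) \<le> (\<integral>\<^sup>+x. emeasure (Q' x \<bind> R x) A + ennreal d \<partial>\<rho>)"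
    using step by (intro nn_integral_mono) (simp add: space_rho)
  also have "\<dots> = (\<integral>\<^sup>+x. emeasure (Q' x \<bind> R x) A \<partial>\<rho>) + ennreal d"
  proof (subst nn_integral_add)
    show "(\<lambda>x. emeasure (Q' x \<bind> R x) A) \<in> borel_measurable \<rho>"
      using measurable_compose[OF measurable_prob_algebraD[OF chan[OF Q']] measurable_emeasure_subprob_algebra[OF A]]
      by (simp add: measurable_cong_sets[OF sets_rho refl])
  qed (simp_all add: rho.emeasure_space_1)
  finally show ?thesis by (simp add: kernel_eq Q Q')
qed

section \<open>Accumulation of the gap along the process\<close>

text \<open>
  In the induction step the last kernel is exchanged first, with the law of the past unchanged; this
  costs \<open>M * d\<close>. The conditional expectation of \<open>f\<close> under the new kernel is a function of the past
  that is again bounded by \<open>M\<close>, so the induction hypothesis exchanges the law of the past. This is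
  why the lemma is stated for functions rather than for events.
\<close>

lemma Ionescu_Tulcea_setwise_gap:
  fixes \<kappa> \<kappa>' :: "nat \<Rightarrow> (nat \<Rightarrow> 'a) \<Rightarrow> 'a measure" and f :: "(nat \<Rightarrow> 'a) \<Rightarrow> ennreal" and d M :: real
  assumes IT: "Ionescu_Tulcea \<kappa> S" and IT': "Ionescu_Tulcea \<kappa>' S"
    and d: "0 \<le> d" and M: "0 \<le> M"
    and gap: "\<And>t h A. h \<in> space (PiM {0..<t} S) \<Longrightarrow> A \<in> sets (S t) \<Longrightarrow>
      emeasure (\<kappa> t h) A \<le> emeasure (\<kappa>' t h) A + ennreal d"
    and f: "f \<in> borel_measurable (PiM {0..<n} S)"
    and f_le: "\<And>h. h \<in> space (PiM {0..<n} S) \<Longrightarrow> f h \<le> ennreal M"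
  shows "(\<integral>\<^sup>+h. f h \<partial>Ionescu_Tulcea.C \<kappa> S 0 n (\<lambda>_. undefined))
           \<le> (\<integral>\<^sup>+h. f h \<partial>Ionescu_Tulcea.C \<kappa>' S 0 n (\<lambda>_. undefined)) + ennreal (real n * (M * d))"
proof -
  interpret I: Ionescu_Tulcea \<kappa> S by fact
  interpret I': Ionescu_Tulcea \<kappa>' S by fact
  show ?thesis
    using f f_le
  proof (induction n arbitrary: f)
    case 0
    then show ?case by simp
  next
    case (Suc n)
    let ?H = "PiM {0..<n} S"
    let ?C = "I.C 0 n (\<lambda>_. undefined)" and ?C' = "I'.C 0 n (\<lambda>_. undefined)"
    let ?g = "\<lambda>h. \<integral>\<^sup>+z. f z \<partial>I.eP n h" and ?g' = "\<lambda>h. \<integral>\<^sup>+z. f z \<partial>I'.eP n h"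
    have u: "(\<lambda>_. undefined) \<in> space (PiM {0..<0} S)" by (simp add: space_PiM)
    interpret C: prob_space ?C by (rule I.prob_space_C[OF u])
    have sets_C: "sets ?C = sets ?H" using I.sets_C[OF u, of n] by simp
    have space_C: "space ?C = space ?H" using sets_C by (rule sets_eq_imp_space_eq)
    have sets_C': "sets ?C' = sets ?H" using I'.sets_C[OF u, of n] by simp
    have eq: "(\<integral>\<^sup>+h. f h \<partial>I.C 0 (Suc n) (\<lambda>_. undefined)) = (\<integral>\<^sup>+h. ?g h \<partial>?C)"
      using Suc.prems(1) I.measurable_eP[of n]
      by (simp add: nn_integral_bind measurable_cong_sets[OF sets_C refl])
    have eq': "(\<integral>\<^sup>+h. f h \<partial>I'.C 0 (Suc n) (\<lambda>_. undefined)) = (\<integral>\<^sup>+h. ?g' h \<partial>?C')"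
      using Suc.prems(1) I'.measurable_eP[of n]
      by (simp add: nn_integral_bind measurable_cong_sets[OF sets_C' refl])
    have g'_meas: "?g' \<in> borel_measurable ?H"
      by (rule measurable_compose[OF I'.measurable_eP nn_integral_measurable_subprob_algebra[OF Suc.prems(1)]])
    have g'_le: "?g' h \<le> ennreal M" if h: "h \<in> space ?H" for h
    proof -
      interpret E: prob_space "I'.eP n h" by (rule I'.prob_space_eP[OF h])
      have "?g' h \<le> (\<integral>\<^sup>+z. ennreal M \<partial>I'.eP n h)"
        using Suc.prems(2) I'.space_eP[OF h] by (intro nn_integral_mono) simp
      then show ?thesis by (simp add: E.emeasure_space_1)
    qed
    have step: "?g h \<le> ?g' h + ennreal (M * d)" if h: "h \<in> space ?H" for h
    proof -
      have upd: "fun_upd h n \<in> S n \<rightarrow>\<^sub>M PiM {0..<Suc n} S"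
        by (rule measurable_fun_upd[where J="{0..<n}"]) (use h in auto)
      have "(\<integral>\<^sup>+z. f (fun_upd h n z) \<partial>\<kappa> n h) \<le> (\<integral>\<^sup>+z. f (fun_upd h n z) \<partial>\<kappa>' n h) + ennreal (M * d)"
        using nn_integral_le_add_setwise_gap[OF I.prob_space_P[OF h] I'.prob_space_P[OF h] I.sets_P[OF h]
            I'.sets_P[OF h] d M gap[OF h] measurable_compose[OF upd Suc.prems(1)]]
          Suc.prems(2) measurable_space[OF upd] by blast
      then show ?thesis
        unfolding I.nn_integral_eP[OF h Suc.prems(1)] I'.nn_integral_eP[OF h Suc.prems(1)] .
    qed
    have "(\<integral>\<^sup>+h. ?g h \<partial>?C) \<le> (\<integral>\<^sup>+h. ?g' h + ennreal (M * d) \<partial>?C)"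
      using step by (intro nn_integral_mono) (simp add: space_C)
    also have "\<dots> = (\<integral>\<^sup>+h. ?g' h \<partial>?C) + ennreal (M * d)"
      using g'_meas by (subst nn_integral_add)
        (simp_all add: measurable_cong_sets[OF sets_C refl] C.emeasure_space_1)
    also have "\<dots> \<le> (\<integral>\<^sup>+h. ?g' h \<partial>?C') + ennreal (real n * (M * d)) + ennreal (M * d)"
      by (intro add_right_mono Suc.IH g'_meas g'_le)
    also have "\<dots> = (\<integral>\<^sup>+h. ?g' h \<partial>?C') + ennreal (real (Suc n) * (M * d))"
      using M d by (simp add: add.assoc ennreal_plus[symmetric] algebra_simps del: ennreal_plus)
    finally show ?case unfolding eq eq' .
  qed
qed

lemma (in Ionescu_Tulcea) CI_initial_segment: "CI {0..<n} = C 0 n (\<lambda>_. undefined)"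
proof (rule measure_eqI)
  have u: "(\<lambda>_. undefined) \<in> space (PiM {0..<0} M)" by (simp add: space_PiM)
  show s: "sets (CI {0..<n}) = sets (C 0 n (\<lambda>_. undefined))"
    using sets_C[OF u, of n] by (simp add: CI_def)
  fix A assume "A \<in> sets (CI {0..<n})"
  then have A: "A \<in> sets (PiM {0..<n} M)" by (simp add: CI_def)
  then show "emeasure (CI {0..<n}) A = emeasure (C 0 n (\<lambda>_. undefined)) A"
    by (subst emeasure_CI[of _ n]) (auto simp: prod_emb_id[OF sets.sets_into_space[OF A, unfolded space_PiM]])
qed

lemma (in Ionescu_Tulcea) prob_space_lim: "prob_space PF.lim"
proof (rule prob_space_distrD)
  show "(\<lambda>x. restrict x {0..<0}) \<in> PF.lim \<rightarrow>\<^sub>M PiM {0..<0} M"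
    by (simp add: measurable_cong_sets[OF PF.sets_lim refl] measurable_restrict_subset)
  show "prob_space (distr PF.lim (PiM {0..<0} M) (\<lambda>x. restrict x {0..<0}))"
    by (subst distr_lim) (auto intro: PF.prob_space_P)
qed

section \<open>The cost of a policy\<close>

lemma cumulative_cost_measurable:
  fixes c :: "'x::euclidean_space \<times> 'u::euclidean_space \<Rightarrow> real"
  assumes c: "c \<in> borel_measurable (borel_on X \<Otimes>\<^sub>M borel_on U)" and J: "{..<T} \<subseteq> J"
  shows "(\<lambda>\<omega>. \<Sum>t<T. c (state_at \<omega> t, control_at \<omega> t))
           \<in> borel_measurable (PiM J (\<lambda>_. stage_space X Y U))"
proof (rule borel_measurable_sum)
  fix t assume "t \<in> {..<T}"
  then have [measurable]: "(\<lambda>\<omega>. \<omega> t) \<in> PiM J (\<lambda>_. stage_space X Y U) \<rightarrow>\<^sub>M stage_space X Y U"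
    using J by (intro measurable_component_singleton) auto
  have "(\<lambda>\<omega>. (state_at \<omega> t, control_at \<omega> t))
      \<in> PiM J (\<lambda>_. stage_space X Y U) \<rightarrow>\<^sub>M borel_on X \<Otimes>\<^sub>M borel_on U"
    by measurable
  from measurable_compose[OF this c]
  show "(\<lambda>\<omega>. c (state_at \<omega> t, control_at \<omega> t)) \<in> borel_measurable (PiM J (\<lambda>_. stage_space X Y U))" .
qed

lemma state_control_in_space:
  assumes "\<omega> \<in> space (PiM J (\<lambda>_. stage_space X Y U))" and "t \<in> J"
  shows "state_at \<omega> t \<in> X" and "control_at \<omega> t \<in> U"
proof -
  have "\<omega> t \<in> space (stage_space X Y U)" using assms by (auto simp: space_PiM PiE_iff)
  then show "state_at \<omega> t \<in> X" and "control_at \<omega> t \<in> U"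
    by (auto simp: space_pair_measure space_restrict_space)
qed

text \<open>
  The cost over the horizon \<open>T\<close> sees only the first \<open>T\<close> stages, so the law on infinite sequences can
  be replaced by the \<open>T\<close>-fold composition of kernels, to which the stagewise estimate applies.
\<close>

lemma policy_cost_eq_nn_integral:
  fixes c :: "'x::euclidean_space \<times> 'u::euclidean_space \<Rightarrow> real"
  assumes P: "P \<in> space (prob_algebra (borel_on X))"
    and K: "K \<in> kernels (borel_on X \<Otimes>\<^sub>M borel_on U) (borel_on X)"
    and Q: "Q \<in> channels X Y"
    and \<gamma>: "\<gamma> \<in> admissible_policies Y U"
    and c: "c \<in> borel_measurable (borel_on X \<Otimes>\<^sub>M borel_on U)"
    and c_nonneg: "\<And>x u. x \<in> X \<Longrightarrow> u \<in> U \<Longrightarrow> 0 \<le> c (x, u)"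
    and c_le: "\<And>x u. x \<in> X \<Longrightarrow> u \<in> U \<Longrightarrow> c (x, u) \<le> b"
  shows "ennreal (policy_cost X Y U K c T P Q \<gamma>) =
    (\<integral>\<^sup>+h. ennreal (\<Sum>t<T. c (state_at h t, control_at h t))
       \<partial>Ionescu_Tulcea.C (stage_kernel X Y U P K Q \<gamma>) (\<lambda>_. stage_space X Y U) 0 T (\<lambda>_. undefined))"
proof -
  let ?S = "stage_space X Y U"
  interpret I: Ionescu_Tulcea "stage_kernel X Y U P K Q \<gamma>" "\<lambda>_. ?S"
    by (rule Ionescu_Tulcea_stage_kernel[OF P K Q \<gamma>])
  let ?L = I.PF.lim
  interpret L: prob_space ?L by (rule I.prob_space_lim)
  let ?f = "\<lambda>\<omega>. \<Sum>t<T. c (state_at \<omega> t, control_at \<omega> t)"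
  have law: "process_law X Y U P K Q \<gamma> = ?L" by (simp add: process_law_def)
  have in_XU: "state_at \<omega> t \<in> X" "control_at \<omega> t \<in> U" if "\<omega> \<in> space ?L" for \<omega> t
    using state_control_in_space[of \<omega> UNIV] that by auto
  have nonneg: "0 \<le> ?f \<omega>" if "\<omega> \<in> space ?L" for \<omega>
    using in_XU[OF that] c_nonneg by (intro sum_nonneg) auto
  have le: "?f \<omega> \<le> real T * b" if "\<omega> \<in> space ?L" for \<omega>
    using sum_bounded_above[of "{..<T}" "\<lambda>t. c (state_at \<omega> t, control_at \<omega> t)" b] in_XU[OF that] c_le by simp
  have f_meas_L: "?f \<in> borel_measurable ?L"
    using cumulative_cost_measurable[OF c subset_UNIV] by (simp add: measurable_cong_sets[OF I.PF.sets_lim refl])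
  have "integrable ?L ?f"
    by (rule L.integrable_const_bound[where B="real T * b", OF _ f_meas_L])
       (use nonneg le in \<open>auto intro!: AE_I2\<close>)
  then have "ennreal (policy_cost X Y U K c T P Q \<gamma>) = (\<integral>\<^sup>+\<omega>. ennreal (?f \<omega>) \<partial>?L)"
    unfolding policy_cost_def law by (intro nn_integral_eq_integral[symmetric]) (use nonneg in \<open>auto intro!: AE_I2\<close>)
  also have "\<dots> = (\<integral>\<^sup>+\<omega>. ennreal (?f (restrict \<omega> {0..<T})) \<partial>?L)"
    by (intro nn_integral_cong arg_cong[where f=ennreal] sum.cong) auto
  also have "\<dots> = (\<integral>\<^sup>+h. ennreal (?f h) \<partial>distr ?L (PiM {0..<T} (\<lambda>_. ?S)) (\<lambda>x. restrict x {0..<T}))"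
  proof -
    have restr: "(\<lambda>x. restrict x {0..<T}) \<in> ?L \<rightarrow>\<^sub>M PiM {0..<T} (\<lambda>_. ?S)"
      by (simp add: measurable_cong_sets[OF I.PF.sets_lim refl] measurable_restrict_subset)
    have "?f \<in> borel_measurable (PiM {0..<T} (\<lambda>_. ?S))"
      by (rule cumulative_cost_measurable[OF c]) auto
    then have "(\<lambda>h. ennreal (?f h)) \<in> borel_measurable (PiM {0..<T} (\<lambda>_. ?S))" by measurable
    then show ?thesis
      by (intro nn_integral_distr[OF restr, where f="\<lambda>h. ennreal (?f h)", symmetric]) simp
  qed
  also have "distr ?L (PiM {0..<T} (\<lambda>_. ?S)) (\<lambda>x. restrict x {0..<T}) = I.C 0 T (\<lambda>_. undefined)"
    by (simp add: I.distr_lim I.CI_initial_segment)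
  finally show ?thesis .
qed

lemma policy_cost_nonneg:
  assumes P: "P \<in> space (prob_algebra (borel_on X))"
    and K: "K \<in> kernels (borel_on X \<Otimes>\<^sub>M borel_on U) (borel_on X)"
    and Q: "Q \<in> channels X Y"
    and \<gamma>: "\<gamma> \<in> admissible_policies Y U"
    and c_nonneg: "\<And>x u. x \<in> X \<Longrightarrow> u \<in> U \<Longrightarrow> 0 \<le> c (x, u)"
  shows "0 \<le> policy_cost X Y U K c T P Q \<gamma>"
proof -
  interpret I: Ionescu_Tulcea "stage_kernel X Y U P K Q \<gamma>" "\<lambda>_. stage_space X Y U"
    by (rule Ionescu_Tulcea_stage_kernel[OF P K Q \<gamma>])
  have "0 \<le> c (state_at \<omega> t, control_at \<omega> t)" if "\<omega> \<in> space I.PF.lim" for \<omega> t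
    using state_control_in_space[of \<omega> UNIV] that by (auto intro!: c_nonneg)
  then show ?thesis
    unfolding policy_cost_def process_law_def by (intro integral_nonneg_AE AE_I2 sum_nonneg) auto
qed

lemma policy_cost_gap:
  fixes c :: "'x::euclidean_space \<times> 'u::euclidean_space \<Rightarrow> real"
  assumes P: "P \<in> space (prob_algebra (borel_on X))"
    and K: "K \<in> kernels (borel_on X \<Otimes>\<^sub>M borel_on U) (borel_on X)"
    and Q: "Q \<in> channels X Y" and Q': "Q' \<in> channels X Y"
    and \<gamma>: "\<gamma> \<in> admissible_policies Y U"
    and c: "c \<in> borel_measurable (borel_on X \<Otimes>\<^sub>M borel_on U)"
    and c_nonneg: "\<And>x u. x \<in> X \<Longrightarrow> u \<in> U \<Longrightarrow> 0 \<le> c (x, u)"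
    and c_le: "\<And>x u. x \<in> X \<Longrightarrow> u \<in> U \<Longrightarrow> c (x, u) \<le> b"
    and b: "0 \<le> b" and d: "0 \<le> d"
    and gap: "\<And>x A. x \<in> X \<Longrightarrow> A \<in> sets (borel_on Y) \<Longrightarrow> emeasure (Q x) A \<le> emeasure (Q' x) A + ennreal d"
  shows "policy_cost X Y U K c T P Q \<gamma> \<le> policy_cost X Y U K c T P Q' \<gamma> + real T * (real T * b * d)"
proof -
  let ?S = "stage_space X Y U"
  let ?f = "\<lambda>h. \<Sum>t<T. c (state_at h t, control_at h t)"
  have f_meas: "(\<lambda>h. ennreal (?f h)) \<in> borel_measurable (PiM {0..<T} (\<lambda>_. ?S))"
    by (intro measurable_compose[OF _ measurable_ennreal] cumulative_cost_measurable[OF c]) auto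
  have f_le: "ennreal (?f h) \<le> ennreal (real T * b)" if h: "h \<in> space (PiM {0..<T} (\<lambda>_. ?S))" for h
  proof (rule ennreal_leI)
    have "c (state_at h t, control_at h t) \<le> b" if "t < T" for t
      using state_control_in_space[OF h] that by (auto intro!: c_le)
    then show "?f h \<le> real T * b"
      using sum_bounded_above[of "{..<T}" "\<lambda>t. c (state_at h t, control_at h t)" b] by simp
  qed
  let ?C = "\<lambda>q. Ionescu_Tulcea.C (stage_kernel X Y U P K q \<gamma>) (\<lambda>_. ?S) 0 T (\<lambda>_. undefined)"
  have cost: "ennreal (policy_cost X Y U K c T P q \<gamma>) = (\<integral>\<^sup>+h. ennreal (?f h) \<partial>?C q)"
    if "q \<in> channels X Y" for q
    by (rule policy_cost_eq_nn_integral[OF P K that \<gamma> c c_nonneg c_le])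
  have Tb: "0 \<le> real T * b" using b by simp
  have "(\<integral>\<^sup>+h. ennreal (?f h) \<partial>?C Q) \<le> (\<integral>\<^sup>+h. ennreal (?f h) \<partial>?C Q') + ennreal (real T * (real T * b * d))"
    by (rule Ionescu_Tulcea_setwise_gap[OF Ionescu_Tulcea_stage_kernel[OF P K Q \<gamma>]
          Ionescu_Tulcea_stage_kernel[OF P K Q' \<gamma>] d Tb stage_kernel_gap[OF P K Q Q' \<gamma> d gap] f_meas f_le])
  then have "ennreal (policy_cost X Y U K c T P Q \<gamma>)
      \<le> ennreal (policy_cost X Y U K c T P Q' \<gamma>) + ennreal (real T * (real T * b * d))"
    by (simp only: cost Q Q')
  then show ?thesis
    using policy_cost_nonneg[where c=c and T=T, OF P K Q' \<gamma> c_nonneg] b d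
    by (simp add: ennreal_plus[symmetric] del: ennreal_plus)
qed

section \<open>The optimal cost and total variation\<close>

lemma admissible_policies_nonempty:
  assumes "U \<noteq> {}"
  shows "admissible_policies Y U \<noteq> {}"
proof -
  obtain u where "u \<in> U" using assms by auto
  then have "(\<lambda>_ _ _. u) \<in> admissible_policies Y U"
    by (simp add: admissible_policies_def space_restrict_space split_beta')
  then show ?thesis by blast
qed

lemma INF_le_INF_add:
  fixes f g :: "'a \<Rightarrow> real"
  assumes ne: "A \<noteq> {}" and bdd: "bdd_below (f ` A)" and le: "\<And>a. a \<in> A \<Longrightarrow> f a \<le> g a + e"
  shows "(INF a\<in>A. f a) \<le> (INF a\<in>A. g a) + e"
proof -
  have "(INF a\<in>A. f a) - e \<le> (INF a\<in>A. g a)"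
  proof (rule cINF_greatest[OF ne])
    fix a assume "a \<in> A"
    then show "(INF a\<in>A. f a) - e \<le> g a"
      using cINF_lower[OF bdd \<open>a \<in> A\<close>] le[OF \<open>a \<in> A\<close>] by linarith
  qed
  then show ?thesis by simp
qed

lemma optimal_cost_gap:
  fixes c :: "'x::euclidean_space \<times> 'u::euclidean_space \<Rightarrow> real"
  assumes U: "U \<noteq> {}"
    and P: "P \<in> space (prob_algebra (borel_on X))"
    and K: "K \<in> kernels (borel_on X \<Otimes>\<^sub>M borel_on U) (borel_on X)"
    and Q: "Q \<in> channels X Y" and Q': "Q' \<in> channels X Y"
    and c: "c \<in> borel_measurable (borel_on X \<Otimes>\<^sub>M borel_on U)"
    and c_nonneg: "\<And>x u. x \<in> X \<Longrightarrow> u \<in> U \<Longrightarrow> 0 \<le> c (x, u)"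
    and c_le: "\<And>x u. x \<in> X \<Longrightarrow> u \<in> U \<Longrightarrow> c (x, u) \<le> b"
    and b: "0 \<le> b" and d: "0 \<le> d"
    and gap: "\<And>x A. x \<in> X \<Longrightarrow> A \<in> sets (borel_on Y) \<Longrightarrow> emeasure (Q x) A \<le> emeasure (Q' x) A + ennreal d"
  shows "optimal_cost X Y U K c T P Q \<le> optimal_cost X Y U K c T P Q' + real T * (real T * b * d)"
  unfolding optimal_cost_def
  using policy_cost_nonneg[where c=c and T=T, OF P K Q _ c_nonneg]
  by (intro INF_le_INF_add admissible_policies_nonempty U bdd_belowI2[where m=0]
      policy_cost_gap[OF P K Q Q' _ c c_nonneg c_le b d gap]) auto

lemma tv_dist_bounds:
  assumes mu: "prob_space \<mu>" and nu: "prob_space \<nu>"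
  shows measure_diff_le_tv_dist: "A \<in> sets N \<Longrightarrow> \<bar>measure \<mu> A - measure \<nu> A\<bar> \<le> tv_dist N \<mu> \<nu>"
    and tv_dist_nonneg: "0 \<le> tv_dist N \<mu> \<nu>"
    and tv_dist_le_2: "tv_dist N \<mu> \<nu> \<le> 2"
proof -
  interpret mu: prob_space \<mu> by fact
  interpret nu: prob_space \<nu> by fact
  let ?D = "\<lambda>B. \<bar>measure \<mu> B - measure \<nu> B\<bar>"
  have D1: "?D B \<le> 1" for B
    using mu.prob_le_1[of B] nu.prob_le_1[of B] measure_nonneg[of \<mu> B] measure_nonneg[of \<nu> B]
    by linarith
  have bdd: "bdd_above (?D ` sets N)" using D1 by (intro bdd_aboveI2)
  have D_le: "?D A \<le> (SUP B\<in>sets N. ?D B)" if "A \<in> sets N" for A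
    using cSUP_upper[OF that bdd] .
  have S0: "0 \<le> (SUP B\<in>sets N. ?D B)"
    using D_le[OF sets.empty_sets] by simp
  show "0 \<le> tv_dist N \<mu> \<nu>" using S0 by (simp add: tv_dist_def)
  show "tv_dist N \<mu> \<nu> \<le> 2"
    using cSUP_least[of "sets N" ?D 1] D1 sets.empty_sets by (auto simp: tv_dist_def)
  show "?D A \<le> tv_dist N \<mu> \<nu>" if "A \<in> sets N"
    using D_le[OF that] S0 by (simp add: tv_dist_def)
qed

text \<open>
  In \<^typ>\<open>real\<close> a supremum bounds its family only if the family is bounded above; here this holds
  because the total variation distance of two probability measures never exceeds \<open>2\<close>.
\<close>

lemma channel_gap_le_sup_tv_dist:
  assumes Q: "Q \<in> channels X Y" and Q': "Q' \<in> channels X Y"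
    and x: "x \<in> X" and A: "A \<in> sets (borel_on Y)"
  defines "d \<equiv> (SUP x\<in>X. tv_dist (borel_on Y) (Q x) (Q' x))"
  shows "emeasure (Q x) A \<le> emeasure (Q' x) A + ennreal d"
    and "emeasure (Q' x) A \<le> emeasure (Q x) A + ennreal d"
    and "0 \<le> d"
proof -
  have prob: "prob_space (q z)" if "q \<in> channels X Y" "z \<in> X" for q z
    using measurable_space[of q "borel_on X" "prob_algebra (borel_on Y)" z] that
    by (auto simp: channels_def space_prob_algebra space_restrict_space)
  interpret Q: prob_space "Q x" by (rule prob[OF Q x])
  interpret Q': prob_space "Q' x" by (rule prob[OF Q' x])
  have "bdd_above ((\<lambda>x. tv_dist (borel_on Y) (Q x) (Q' x)) ` X)"
    using tv_dist_le_2 prob Q Q' by (intro bdd_aboveI2[where M=2]) blast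
  then have le: "tv_dist (borel_on Y) (Q x) (Q' x) \<le> d"
    unfolding d_def using x by (intro cSUP_upper)
  show d: "0 \<le> d"
    using tv_dist_nonneg[OF Q.prob_space_axioms Q'.prob_space_axioms] le by (rule order_trans)
  have "\<bar>measure (Q x) A - measure (Q' x) A\<bar> \<le> d"
    using measure_diff_le_tv_dist[OF Q.prob_space_axioms Q'.prob_space_axioms A] le by (rule order_trans)
  then show "emeasure (Q x) A \<le> emeasure (Q' x) A + ennreal d"
    and "emeasure (Q' x) A \<le> emeasure (Q x) A + ennreal d"
    using d by (auto simp: Q.emeasure_eq_measure Q'.emeasure_eq_measure ennreal_plus[symmetric]
        simp del: ennreal_plus)
qed

theorem theorem6p2:
  fixes X :: "'x::euclidean_space set"
    and Y :: "'y::euclidean_space set"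
    and U :: "'u::euclidean_space set"
    and P :: "'x measure"
    and K :: "'x \<times> 'u \<Rightarrow> 'x measure"
    and c :: "'x \<times> 'u \<Rightarrow> real"
    and T :: nat
    and Q :: "'x \<Rightarrow> 'y measure"
    and Qn :: "nat \<Rightarrow> 'x \<Rightarrow> 'y measure"
  assumes "X \<in> sets borel" and "Y \<in> sets borel" and "U \<in> sets borel" and "U \<noteq> {}"
    and "P \<in> space (prob_algebra (borel_on X))"
    and "K \<in> kernels (borel_on X \<Otimes>\<^sub>M borel_on U) (borel_on X)"
    and "c \<in> borel_measurable (borel_on X \<Otimes>\<^sub>M borel_on U)"
    and "\<forall>x\<in>X. \<forall>u\<in>U. 0 \<le> c (x, u)"
    and "bounded (c ` (X \<times> U))"
    and "Q \<in> channels X Y" and "\<forall>n. Qn n \<in> channels X Y"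
    and "uniform_tv_converges X Y Qn Q"
  shows "(\<lambda>n. optimal_cost X Y U K c T P (Qn n)) \<longlonglongrightarrow> optimal_cost X Y U K c T P Q"
proof -
  define d where "d n = (SUP x\<in>X. tv_dist (borel_on Y) (Qn n x) (Q x))" for n
  have d_lim: "d \<longlonglongrightarrow> 0"
    using assms(12) by (simp add: uniform_tv_converges_def d_def[abs_def])
  have Qn: "Qn n \<in> channels X Y" for n using assms(11) by blast
  have c_nonneg: "0 \<le> c (x, u)" if "x \<in> X" "u \<in> U" for x u
    using assms(8) that by blast
  obtain b where b: "0 < b" and c_norm: "\<And>z. z \<in> c ` (X \<times> U) \<Longrightarrow> norm z \<le> b"
    using assms(9) unfolding bounded_pos by blast
  have c_le: "c (x, u) \<le> b" if "x \<in> X" "u \<in> U" for x u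
    using c_norm[of "c (x, u)"] that imageI[of "(x, u)" "X \<times> U" c] by (simp add: abs_le_iff)
  \<comment> \<open>A point of \<open>X\<close> is needed to see that the supremum \<open>d n\<close> is non-negative.\<close>
  have "X \<noteq> {}"
  proof -
    have P: "prob_space P" "sets P = sets (borel_on X)"
      using assms(5) by (simp_all add: space_prob_algebra)
    have "space P = X"
      using sets_eq_imp_space_eq[OF P(2)] by (simp add: space_restrict_space)
    with prob_space.not_empty[OF P(1)] show ?thesis by simp
  qed
  then obtain x0 where x0: "x0 \<in> X" by blast
  note gap = channel_gap_le_sup_tv_dist[OF Qn assms(10), folded d_def]
  have d0: "0 \<le> d n" for n using gap(3)[OF x0 sets.empty_sets] .
  have bound: "norm (optimal_cost X Y U K c T P (Qn n) - optimal_cost X Y U K c T P Q)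
      \<le> real T * (real T * b * d n)" for n
  proof -
    have "optimal_cost X Y U K c T P (Qn n) \<le> optimal_cost X Y U K c T P Q + real T * (real T * b * d n)"
      by (rule optimal_cost_gap[OF assms(4-6) Qn assms(10) assms(7) c_nonneg c_le less_imp_le[OF b] d0 gap(1)])
    moreover have "optimal_cost X Y U K c T P Q \<le> optimal_cost X Y U K c T P (Qn n) + real T * (real T * b * d n)"
      by (rule optimal_cost_gap[OF assms(4-6) assms(10) Qn assms(7) c_nonneg c_le less_imp_le[OF b] d0 gap(2)])
    ultimately show ?thesis by (simp add: abs_le_iff)
  qed
  have "(\<lambda>n. real T * (real T * b * d n)) \<longlonglongrightarrow> real T * (real T * b * 0)"
    by (intro tendsto_mult tendsto_const d_lim)
  then have "(\<lambda>n. real T * (real T * b * d n)) \<longlonglongrightarrow> 0" by simp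
  with always_eventually[OF allI[OF bound]]
  have "(\<lambda>n. optimal_cost X Y U K c T P (Qn n) - optimal_cost X Y U K c T P Q) \<longlonglongrightarrow> 0"
    by (rule Lim_null_comparison)
  then show ?thesis by (rule LIM_zero_cancel)
qed

end
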